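(* For all integers $p,q,r$ with $2 \leq p \leq q \leq r$, except when $p=q=2$ and $r>2$, there exists a connected graph $G_{p,q,r}$ satisfying $\chi(G_{p,q,r}) = p$, $\chi_{L}(G_{p,q,r}) = q$, and $\chi_{NL}(G_{p,q,r}) = r$.
   Context: All graphs are finite and simple. $\chi(G)$ is the chromatic number. For a proper $k$-coloring $f$ of $G$ with color classes $S_1,\dots,S_k$, two vertices $x,y$ are metric-distinguished if $d(x,S_i)\neq d(y,S_i)$ for some $i$, where $d(x,S)=\min\{d(x,z): z\in S\}$ and $d$ is the shortest-path distance; $f$ is a locating $k$-coloring if any two distinct vertices are metric-distinguished. The locating chromatic number $\chi_L(G)$ is the minimum $k$ for which $G$ admits a locating $k$-coloring. For a vertex $x$, let $N_f(x)=\{f(y): y \text{ adjacent to } x\}$ (the set of color-neighbors of $x$). Two vertices $x,y$ are neighbor-distinguished if $f(x)\neq f(y)$ or $N_f(x)\neq N_f(y)$; $f$ is a neighbor-locating $k$-coloring if every two distinct vertices are neighbor-distinguished. The neighbor-locating chromatic number $\chi_{NL}(G)$ is the minimum $k$ for which $G$ admits a neighbor-locating $k$-coloring. *)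

theory Defs
  imports "Graph_Theory.Graph_Theory"
begin

text \<open>
  A finite simple graph is a \<open>pair_graph\<close>: a finite loop-free symmetric digraph whose arcs are
  ordered pairs of vertices, so an edge is represented by its two orientations.
\<close>

definition color_class :: "'a pair_pre_digraph \<Rightarrow> ('a \<Rightarrow> nat) \<Rightarrow> nat \<Rightarrow> 'a set" where
  "color_class G f i = {x \<in> pverts G. f x = i}"

text \<open>
  All \<open>k\<close> colors are used, so the color classes form a partition into \<open>k\<close> nonempty
  independent sets. Allowing unused colors would not change any of the three minima below, since
  an unused color never distinguishes two vertices and can be dropped.
\<close>

definition proper_coloring :: "'a pair_pre_digraph \<Rightarrow> nat \<Rightarrow> ('a \<Rightarrow> nat) \<Rightarrow> bool" where
  "proper_coloring G k f \<longleftrightarrow> f ` pverts G = {1..k} \<and> (\<forall>(x, y) \<in> parcs G. f x \<noteq> f y)"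

text \<open>\<open>\<mu>\<close> is the minimum cost of a walk; with unit arc costs it is the shortest-path distance.\<close>

definition graph_dist :: "'a pair_pre_digraph \<Rightarrow> 'a \<Rightarrow> 'a \<Rightarrow> ereal" where
  "graph_dist G x y = wf_digraph.\<mu> (with_proj G) (\<lambda>_. 1) x y"

text \<open>The infimum is a minimum, as \<open>S\<close> is always a nonempty finite color class.\<close>

definition set_dist :: "'a pair_pre_digraph \<Rightarrow> 'a \<Rightarrow> 'a set \<Rightarrow> ereal" where
  "set_dist G x S = (INF z\<in>S. graph_dist G x z)"

definition metric_distinguished ::
    "'a pair_pre_digraph \<Rightarrow> nat \<Rightarrow> ('a \<Rightarrow> nat) \<Rightarrow> 'a \<Rightarrow> 'a \<Rightarrow> bool" where
  "metric_distinguished G k f x y \<longleftrightarrow>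
     (\<exists>i\<in>{1..k}. set_dist G x (color_class G f i) \<noteq> set_dist G y (color_class G f i))"

definition locating_coloring :: "'a pair_pre_digraph \<Rightarrow> nat \<Rightarrow> ('a \<Rightarrow> nat) \<Rightarrow> bool" where
  "locating_coloring G k f \<longleftrightarrow> proper_coloring G k f \<and>
     (\<forall>x\<in>pverts G. \<forall>y\<in>pverts G. x \<noteq> y \<longrightarrow> metric_distinguished G k f x y)"

definition color_neighbors :: "'a pair_pre_digraph \<Rightarrow> ('a \<Rightarrow> nat) \<Rightarrow> 'a \<Rightarrow> nat set" where
  "color_neighbors G f x = f ` {y. (x, y) \<in> parcs G}"

definition neighbor_distinguished ::
    "'a pair_pre_digraph \<Rightarrow> ('a \<Rightarrow> nat) \<Rightarrow> 'a \<Rightarrow> 'a \<Rightarrow> bool" where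
  "neighbor_distinguished G f x y \<longleftrightarrow> f x \<noteq> f y \<or> color_neighbors G f x \<noteq> color_neighbors G f y"

definition neighbor_locating_coloring :: "'a pair_pre_digraph \<Rightarrow> nat \<Rightarrow> ('a \<Rightarrow> nat) \<Rightarrow> bool" where
  "neighbor_locating_coloring G k f \<longleftrightarrow> proper_coloring G k f \<and>
     (\<forall>x\<in>pverts G. \<forall>y\<in>pverts G. x \<noteq> y \<longrightarrow> neighbor_distinguished G f x y)"

text \<open>
  For a finite graph the minima exist: giving all vertices different colors is a coloring of each
  of the three kinds.
\<close>

definition chromatic_number :: "'a pair_pre_digraph \<Rightarrow> nat" where
  "chromatic_number G = (LEAST k. \<exists>f. proper_coloring G k f)"

definition locating_chromatic_number :: "'a pair_pre_digraph \<Rightarrow> nat" where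
  "locating_chromatic_number G = (LEAST k. \<exists>f. locating_coloring G k f)"

definition neighbor_locating_chromatic_number :: "'a pair_pre_digraph \<Rightarrow> nat" where
  "neighbor_locating_chromatic_number G = (LEAST k. \<exists>f. neighbor_locating_coloring G k f)"

end

(* Let the vertices 1, ..., q induce the complete p-partite graph K(1, ..., 1, q-p+1), where q is
   adjacent to all others, and attach a pendant path at q. The chromatic number is p for every
   length of the path. Among 1, ..., q any two vertices are adjacent or twins, so a locating
   coloring needs q colors; q colors suffice because some color t is used only on the vertex t,
   and the distance to t tells the vertices of the path apart. Adding one vertex increases the
   neighbor-locating chromatic number by at most 1 (give the new vertex a new color), and a graph
   with a neighbor-locating k-coloring has at most k * 2^k vertices. So, as the path grows, the
   neighbor-locating chromatic number starts at q, is unbounded and never jumps over r. *)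

theory Submission
  imports Defs
begin

section \<open>Distances from a vertex to a set of vertices\<close>

context pair_wf_digraph
begin

lemma awalk_cost_one: "awalk_cost (\<lambda>_. 1) w = real (length w)"
  by (simp add: awalk_cost_def sum_list_triv)

lemma set_dist_le_walk: "awalk x w z \<Longrightarrow> z \<in> S \<Longrightarrow> set_dist G x S \<le> ereal (real (length w))"
  unfolding set_dist_def graph_dist_def
  by (rule INF_lower2, assumption)
    (use min_cost_le_walk_cost[of x w z "\<lambda>_. 1"] in \<open>simp add: awalk_cost_one\<close>)

lemma set_dist_greatest:
  assumes "\<And>z w. z \<in> S \<Longrightarrow> awalk x w z \<Longrightarrow> b \<le> ereal (real (length w))"
  shows "b \<le> set_dist G x S"
  unfolding set_dist_def graph_dist_def \<mu>_def awalk_cost_one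
  using assms by (auto intro!: INF_greatest)

lemma set_dist_member: "x \<in> pverts G \<Longrightarrow> x \<in> S \<Longrightarrow> set_dist G x S = 0"
  using set_dist_le_walk[of x "[]" x S] set_dist_greatest[of S x 0]
  by (auto simp: awalk_Nil_iff zero_ereal_def intro!: antisym)

text \<open>Along each arc \<open>h\<close> drops by at most 1, so a walk from \<open>x\<close> to a
  zero of \<open>h\<close> has at least \<open>h x\<close> arcs. The positive lower bounds on
  distances below come from suitable choices of \<open>h\<close>.\<close>

lemma set_dist_ge_potential:
  fixes h :: "'a \<Rightarrow> nat"
  assumes zero: "\<And>z. z \<in> S \<Longrightarrow> h z = 0"
    and step: "\<And>u v. (u, v) \<in> parcs G \<Longrightarrow> h u \<le> Suc (h v)"
  shows "ereal (real (h x)) \<le> set_dist G x S"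
proof (rule set_dist_greatest)
  fix z w assume z: "z \<in> S" and "awalk x w z"
  from this(2) have "h x \<le> length w + h z"
  proof (induction w arbitrary: x)
    case (Cons e w)
    then show ?case using step[of x "snd e"] by (fastforce simp: awalk_Cons_iff)
  qed (simp add: awalk_Nil_iff)
  then show "ereal (real (h x)) \<le> ereal (real (length w))" using zero[OF z] by simp
qed

lemma set_dist_step_le:
  assumes "(x, y) \<in> parcs G"
  shows "set_dist G x S \<le> 1 + set_dist G y S"
proof -
  \<comment> \<open>The 1 moves to the left so that a fixed value is compared with an infimum, walk
    by walk.\<close>
  have "set_dist G x S - 1 \<le> set_dist G y S"
  proof (rule set_dist_greatest)
    fix z w assume "z \<in> S" "awalk y w z"
    then have "set_dist G x S \<le> ereal (real (length ((x, y) # w)))"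
      using assms by (intro set_dist_le_walk[of _ _ z]) (auto simp: awalk_Cons_iff dest: in_arcsD1)
    then show "set_dist G x S - 1 \<le> ereal (real (length w))"
      by (simp add: ereal_minus_le one_ereal_def add.commute)
  qed
  then show ?thesis by (simp add: ereal_minus_le add.commute)
qed

text \<open>Outside \<open>S\<close> the empty walk is excluded, so every walk to \<open>S\<close>
  splits off a first arc. The distance is thus determined by the set of out-neighbors, which is what
  twins share.\<close>

lemma set_dist_step:
  assumes "x \<notin> S"
  shows "set_dist G x S = (INF y\<in>{y. (x, y) \<in> parcs G}. 1 + set_dist G y S)" (is "_ = ?R")
proof (rule antisym)
  show "set_dist G x S \<le> ?R" by (auto intro!: INF_greatest set_dist_step_le)
  show "?R \<le> set_dist G x S"
  proof (rule set_dist_greatest)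
    fix z w assume z: "z \<in> S" "awalk x w z"
    with assms obtain y w' where w: "w = (x, y) # w'" "(x, y) \<in> parcs G" "awalk y w' z"
      by (cases w) (auto simp: awalk_simps)
    have "?R \<le> 1 + set_dist G y S" using w by (intro INF_lower) auto
    also have "\<dots> \<le> 1 + ereal (real (length w'))"
      using set_dist_le_walk[OF w(3) z(1)] by (rule add_left_mono)
    finally show "?R \<le> ereal (real (length w))" by (simp add: w one_ereal_def)
  qed
qed

lemma set_dist_twins:
  assumes "{w. (x, w) \<in> parcs G} = {w. (y, w) \<in> parcs G}" "x \<notin> S" "y \<notin> S"
  shows "set_dist G x S = set_dist G y S"
  using assms by (simp add: set_dist_step)

lemma set_dist_ge_one:
  assumes "x \<notin> S"
  shows "1 \<le> set_dist G x S"
proof -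
  \<comment> \<open>The test \<open>x = x\<close> is kept so that the left side is literally the
    indicator of \<open>x\<close>, used as potential, at the point \<open>x\<close>.\<close>
  have "ereal (real (if x = x then 1 else 0)) \<le> set_dist G x S"
    by (rule set_dist_ge_potential[of S "\<lambda>v. if v = x then 1 else 0"]) (use assms in auto)
  then show ?thesis by (simp add: one_ereal_def)
qed

lemma set_dist_ge_two:
  assumes "x \<notin> S" "\<And>y. (x, y) \<in> parcs G \<Longrightarrow> y \<notin> S"
  shows "2 \<le> set_dist G x S"
proof -
  \<comment> \<open>The potential descends from 2 at \<open>x\<close> through 1 on its neighbors to
    0; by assumption it vanishes on \<open>S\<close>.\<close>
  let ?h = "\<lambda>v. if v = x then 2 else if (x, v) \<in> parcs G then 1 else 0"
  have "ereal (real (?h x)) \<le> set_dist G x S"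
    by (rule set_dist_ge_potential[of S ?h]) (use assms in auto)
  then show ?thesis by simp
qed

lemma set_dist_adjacent:
  assumes "(x, y) \<in> parcs G" "x \<notin> S" "y \<in> S"
  shows "set_dist G x S = 1"
  using set_dist_step_le[OF assms(1), of S] set_dist_ge_one[OF assms(2)]
    set_dist_member[of y S] assms by (auto dest: in_arcsD2 intro: antisym)

section \<open>Colors and twins in locating colorings\<close>

lemma metric_distinguished_if_color_neq:
  assumes "proper_coloring G k f" "x \<in> pverts G" "f x \<noteq> f y"
  shows "metric_distinguished G k f x y"
proof -
  let ?S = "color_class G f (f x)"
  have "set_dist G x ?S = 0" "1 \<le> set_dist G y ?S"
    using assms by (auto intro!: set_dist_member set_dist_ge_one simp: color_class_def)
  moreover have "f x \<in> {1..k}" using assms by (auto simp: proper_coloring_def)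
  ultimately show ?thesis unfolding metric_distinguished_def by force
qed

lemma metric_distinguished_commute:
  "metric_distinguished G k f x y \<longleftrightarrow> metric_distinguished G k f y x"
  unfolding metric_distinguished_def by metis

text \<open>Twins of the same color lie either both in a class, at distance 0, or both outside it,
  at equal distance because their neighbors agree.\<close>

lemma locating_coloring_twins:
  assumes "locating_coloring G k f" "x \<in> pverts G" "y \<in> pverts G" "x \<noteq> y"
    and "{w. (x, w) \<in> parcs G} = {w. (y, w) \<in> parcs G}"
  shows "f x \<noteq> f y"
proof
  assume eq: "f x = f y"
  obtain i where "set_dist G x (color_class G f i) \<noteq> set_dist G y (color_class G f i)"
    using assms unfolding locating_coloring_def metric_distinguished_def by blast
  moreover have "x \<in> color_class G f i \<longleftrightarrow> y \<in> color_class G f i"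
    using eq assms by (simp add: color_class_def)
  ultimately show False
    using assms(2,3) set_dist_member[of x "color_class G f i"]
      set_dist_member[of y "color_class G f i"] set_dist_twins[OF assms(5), of "color_class G f i"]
    by metis
qed

end

section \<open>Counting bounds and a discrete intermediate value argument\<close>

lemma proper_coloring_card_le:
  assumes "proper_coloring G k f" "inj_on f A" "A \<subseteq> pverts G"
  shows "card A \<le> k"
proof -
  have "f ` A \<subseteq> {1..k}" using assms by (auto simp: proper_coloring_def)
  from card_mono[OF _ this] show ?thesis using assms by (simp add: card_image)
qed

text \<open>A vertex is determined by its color together with its set of color-neighbors, and
  \<open>k\<close> colors allow at most \<open>k * 2 ^ k\<close> such pairs.\<close>

lemma neighbor_locating_coloring_card_le:
  assumes f: "neighbor_locating_coloring G k f" and G: "pair_wf_digraph G"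
  shows "card (pverts G) \<le> k * 2 ^ k"
proof -
  interpret pair_wf_digraph G by (rule G)
  let ?g = "\<lambda>x. (f x, color_neighbors G f x)"
  have "inj_on ?g (pverts G)"
    using f unfolding inj_on_def neighbor_locating_coloring_def neighbor_distinguished_def by auto
  moreover have "?g ` pverts G \<subseteq> {1..k} \<times> Pow {1..k}"
    using f unfolding neighbor_locating_coloring_def proper_coloring_def color_neighbors_def
    by (fastforce dest: in_arcsD2)
  ultimately have "card (pverts G) \<le> card ({1..k} \<times> Pow {1..k})"
    by (intro card_inj_on_le) auto
  then show ?thesis by (simp add: card_cartesian_product card_Pow)
qed

text \<open>At the first \<open>n\<close> from \<open>m\<close> on where \<open>F\<close> reaches
  \<open>r\<close>, either \<open>n = m\<close> or the preceding value is below \<open>r\<close>;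
  since \<open>F\<close> rises by at most 1 per step, it cannot overshoot.\<close>

lemma least_step_bounded_nat:
  fixes F :: "nat \<Rightarrow> nat"
  assumes "F m \<le> r" "\<And>n. F (Suc n) \<le> Suc (F n)" "\<exists>n\<ge>m. r \<le> F n"
  shows "\<exists>n\<ge>m. F n = r"
proof -
  define n where "n = (LEAST n. m \<le> n \<and> r \<le> F n)"
  have n: "m \<le> n" "r \<le> F n"
    using LeastI_ex[of "\<lambda>n. m \<le> n \<and> r \<le> F n"] assms(3) by (auto simp: n_def)
  have "F n \<le> r"
  proof (cases "n = m")
    case False
    then obtain l where l: "n = Suc l" "m \<le> l" using n by (cases n) auto
    then have "\<not> r \<le> F l" using not_less_Least[of l "\<lambda>n. m \<le> n \<and> r \<le> F n"] by (auto simp: n_def)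
    then show ?thesis using assms(2)[of l] l by simp
  qed (use assms in simp)
  with n show ?thesis by auto
qed

section \<open>The graphs with a pendant path\<close>

text \<open>Each edge is described from its smaller end. For \<open>u < v < q\<close> it is missing
  only if both ends lie in the part from \<open>p - 1\<close> to \<open>q - 1\<close>, which is
  decided by \<open>u\<close> alone.\<close>

definition tailed_adj :: "nat \<Rightarrow> nat \<Rightarrow> nat \<Rightarrow> nat \<Rightarrow> bool" where
  "tailed_adj p q u v \<longleftrightarrow> u < v \<and> (if v < q then Suc u < p else v = q \<or> v = Suc u)"

text \<open>For \<open>2 \<le> p \<le> q\<close>, the vertices \<open>1, \<dots>, q\<close> induce the complete \<open>p\<close>-partite graph with parts
  \<open>{1}, \<dots>, {p - 2}, {p - 1, \<dots>, q - 1}, {q}\<close>, and \<open>q, q + 1, \<dots>, q + n\<close> is a pendant path.\<close>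

definition tailed_graph :: "nat \<Rightarrow> nat \<Rightarrow> nat \<Rightarrow> nat pair_pre_digraph" where
  "tailed_graph p q n = \<lparr> pverts = {1..q + n},
     parcs = {(u, v). u \<in> {1..q + n} \<and> v \<in> {1..q + n} \<and> (tailed_adj p q u v \<or> tailed_adj p q v u)} \<rparr>"

lemma tailed_graph_simps [simp]:
  "pverts (tailed_graph p q n) = {1..q + n}"
  "(u, v) \<in> parcs (tailed_graph p q n) \<longleftrightarrow>
     u \<in> {1..q + n} \<and> v \<in> {1..q + n} \<and> (tailed_adj p q u v \<or> tailed_adj p q v u)"
  by (auto simp: tailed_graph_def)

lemma pair_graph_tailed_graph: "pair_graph (tailed_graph p q n)"
proof
  show "finite (parcs (tailed_graph p q n))"
    by (rule finite_subset[of _ "{1..q + n} \<times> {1..q + n}"]) (auto simp: tailed_graph_def)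
  show "symmetric (with_proj (tailed_graph p q n))"
    by (auto simp: symmetric_def sym_def)
qed (auto simp: tailed_graph_def tailed_adj_def)

lemma pair_wf_tailed_graph: "pair_wf_digraph (tailed_graph p q n)"
  using pair_graph_tailed_graph by (metis pair_graph_def pair_digraph.pair_wf_digraph)

lemma connected_tailed_graph:
  assumes "2 \<le> p" "p \<le> q"
  shows "Digraph_Component.connected (with_proj (tailed_graph p q n))"
proof -
  interpret pair_graph "tailed_graph p q n" by (rule pair_graph_tailed_graph)
  \<comment> \<open>Since \<open>q\<close> is adjacent to all earlier vertices and starts the path,
    it serves as a hub; by symmetry any two vertices are joined through it.\<close>
  have *: "q \<rightarrow>\<^sup>*\<^bsub>with_proj (tailed_graph p q n)\<^esub> v" if "v \<in> {1..q + n}" for v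
    using that
  proof (induction v)
    case (Suc v)
    consider "Suc v < q" | "Suc v = q" | "q \<le> v" by linarith
    then show ?case
    proof cases
      case 1
      then have "(q, Suc v) \<in> parcs (tailed_graph p q n)" using assms by (simp add: tailed_adj_def)
      then show ?thesis by (intro reachable_adjI) simp
    next
      case 3
      then have "(v, Suc v) \<in> parcs (tailed_graph p q n)" using assms Suc by (simp add: tailed_adj_def)
      moreover have "q \<rightarrow>\<^sup>*\<^bsub>with_proj (tailed_graph p q n)\<^esub> v" using Suc 3 assms by auto
      ultimately show ?thesis by (metis reachable_adj_trans with_proj_simps(3))
    qed (use assms in auto)
  qed simp
  have "u \<rightarrow>\<^sup>*\<^bsub>with_proj (tailed_graph p q n)\<^esub> v" if "u \<in> {1..q + n}" "v \<in> {1..q + n}" for u v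
    using *[OF that(1)] *[OF that(2)] symmetric_reachable' reachable_trans by blast
  then have "u \<rightarrow>\<^sup>*\<^bsub>with_proj (mk_symmetric (with_proj (tailed_graph p q n)))\<^esub> v"
    if "u \<in> {1..q + n}" "v \<in> {1..q + n}" for u v
    using that reachable_mk_symmetricI by blast
  then show ?thesis
    unfolding connected_def using assms by (intro strongly_connectedI) auto
qed

section \<open>The chromatic number\<close>

lemma chromatic_number_tailed_graph:
  assumes "2 \<le> p" "p \<le> q"
  shows "chromatic_number (tailed_graph p q n) = p"
  unfolding chromatic_number_def
proof (rule Least_equality)
  \<comment> \<open>The minimum gives each singleton part below \<open>q\<close> its own color and
    \<open>p - 1\<close> to the whole large part; from \<open>q\<close> on, the path alternates
    between \<open>p\<close> and \<open>p - 1\<close>.\<close>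
  let ?f = "\<lambda>v. if v < q then min v (p - 1) else if even (v - q) then p else p - 1"
  have "?f ` {1..q + n} = {1..p}"
  proof
    show "{1..p} \<subseteq> ?f ` {1..q + n}"
    proof
      fix c assume "c \<in> {1..p}"
      then show "c \<in> ?f ` {1..q + n}"
        using assms by (intro image_eqI[of _ _ "if c = p then q else c"]) auto
    qed
  qed (use assms in auto)
  moreover have "?f u \<noteq> ?f v" if "tailed_adj p q u v" for u v
  proof -
    from that consider "u < v" "v < q" "Suc u < p" | "u < q" "v = q" | "q \<le> u" "v = Suc u"
      by (auto simp: tailed_adj_def split: if_splits; linarith)
    then show ?thesis
    proof cases
      case 3
      then show ?thesis using assms by (auto simp: Suc_diff_le)
    qed (use assms in auto)
  qed
  ultimately have "proper_coloring (tailed_graph p q n) p ?f"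
    unfolding proper_coloring_def tailed_graph_simps(1) by fastforce
  then show "\<exists>f. proper_coloring (tailed_graph p q n) p f" by blast
next
  fix k assume "\<exists>f. proper_coloring (tailed_graph p q n) k f"
  then obtain f where f: "proper_coloring (tailed_graph p q n) k f" by blast
  \<comment> \<open>A clique with one vertex from each of the \<open>p\<close> parts;
    \<open>q - 1\<close> represents the large part.\<close>
  let ?A = "insert q (insert (q - 1) {1..<p - 1})"
  have "inj_on f ?A"
  proof (rule linorder_inj_onI)
    fix x y assume "x < y" "x \<in> ?A" "y \<in> ?A"
    then have "(x, y) \<in> parcs (tailed_graph p q n)" using assms by (auto simp: tailed_adj_def)
    then show "f x \<noteq> f y" using f unfolding proper_coloring_def by blast
  qed auto
  moreover have "?A \<subseteq> pverts (tailed_graph p q n)" using assms by auto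
  moreover have "card ?A = p" using assms by (auto simp: card_insert_if)
  ultimately show "p \<le> k" using proper_coloring_card_le f by metis
qed

section \<open>The locating chromatic number\<close>

text \<open>The second color on the path is chosen so that, for \<open>3 \<le> q\<close>, some color
  stays on a single vertex \<open>t\<close>: \<open>t = q\<close> if \<open>p = 2\<close>, and
  \<open>t = 2\<close> otherwise. With \<open>p > 2\<close>, the choice \<open>t = 2\<close>
  separates \<open>1\<close> (distance 1) from \<open>q + 1\<close> (distance 2), which
  \<open>t = q\<close> would not do.\<close>

definition tailed_color :: "nat \<Rightarrow> nat \<Rightarrow> nat \<Rightarrow> nat" where
  "tailed_color p q v = (if v \<le> q then v else if odd (v - q) then 1 else if p = 2 then 2 else q)"

lemma proper_coloring_tailed_color:
  assumes "2 \<le> p" "p \<le> q"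
  shows "proper_coloring (tailed_graph p q n) q (tailed_color p q)"
proof -
  have "{1..q} \<subseteq> tailed_color p q ` {1..q + n}"
  proof
    fix c assume "c \<in> {1..q}"
    then show "c \<in> tailed_color p q ` {1..q + n}"
      by (intro image_eqI[of _ _ c]) (auto simp: tailed_color_def)
  qed
  moreover have "tailed_color p q u \<noteq> tailed_color p q v" if "tailed_adj p q u v" for u v
    using that assms by (cases "q = 2") (auto simp: tailed_adj_def tailed_color_def split: if_splits)
  ultimately show ?thesis
    using assms unfolding proper_coloring_def
    by (fastforce simp: tailed_color_def)
qed

lemma set_dist_tail:
  assumes "2 \<le> p" "p \<le> q" "1 \<le> t" "t \<le> q" "j \<le> n"
  shows "set_dist (tailed_graph p q n) (q + j) {t} = ereal (real (if t = q then j else Suc j))"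
proof (rule antisym)
  interpret pair_graph "tailed_graph p q n" by (rule pair_graph_tailed_graph)
  show "set_dist (tailed_graph p q n) (q + j) {t} \<le> ereal (real (if t = q then j else Suc j))"
    using assms(5)
  proof (induction j)
    case 0
    show ?case
    proof (cases "t = q")
      case False
      then have "(q, t) \<in> parcs (tailed_graph p q n)" using assms by (auto simp: tailed_adj_def)
      then show ?thesis using set_dist_adjacent[of q t "{t}"] False by (auto simp: one_ereal_def)
    qed (use assms in \<open>auto simp: set_dist_member\<close>)
  next
    case (Suc j)
    then have "(q + Suc j, q + j) \<in> parcs (tailed_graph p q n)" using assms by (auto simp: tailed_adj_def)
    from set_dist_step_le[OF this, of "{t}"] Suc add_left_mono[OF Suc.IH, of 1]
    have "set_dist (tailed_graph p q n) (q + Suc j) {t} \<le> 1 + ereal (real (if t = q then j else Suc j))"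
      by (meson Suc_leD order_trans)
    then show ?case by (simp add: one_ereal_def split: if_splits)
  qed
  \<comment> \<open>On the path this is the claimed distance. Below \<open>q\<close> the value 1
    suffices as a lower bound, even for twins of \<open>t\<close>, whose distance is 2.\<close>
  let ?h = "\<lambda>v. if v = t then 0 else if v < q then 1 else if t = q then v - q else Suc (v - q)"
  have "ereal (real (?h (q + j))) \<le> set_dist (tailed_graph p q n) (q + j) {t}"
    using assms by (intro set_dist_ge_potential) (auto simp: tailed_adj_def split: if_splits)
  then show "ereal (real (if t = q then j else Suc j)) \<le> set_dist (tailed_graph p q n) (q + j) {t}"
    using assms by (auto split: if_splits)
qed

lemma color_class_tailed_color:
  assumes "2 \<le> p" "p \<le> q" "3 \<le> q" "t = (if p = 2 then q else 2)"
  shows "color_class (tailed_graph p q n) (tailed_color p q) t = {t}"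
  using assms by (auto simp: color_class_def tailed_color_def split: if_splits)

text \<open>The condition on \<open>n\<close> is needed: for \<open>p = 2\<close>, \<open>n = 1\<close> the vertices \<open>1\<close> and \<open>q + 1\<close> are twins of
  the same color. For longer paths, \<open>q + 1\<close> is adjacent to color \<open>2\<close> and \<open>1\<close> is not.\<close>

lemma locating_coloring_tailed_color:
  assumes "2 \<le> p" "p \<le> q" "n = 0 \<or> 3 \<le> q \<and> (p = 2 \<longrightarrow> 2 \<le> n)"
  shows "locating_coloring (tailed_graph p q n) q (tailed_color p q)"
proof -
  interpret pair_graph "tailed_graph p q n" by (rule pair_graph_tailed_graph)
  let ?G = "tailed_graph p q n"
  have proper: "proper_coloring ?G q (tailed_color p q)" using assms by (intro proper_coloring_tailed_color)
  have "metric_distinguished ?G q (tailed_color p q) x y"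
    if xy: "1 \<le> x" "x < y" "y \<le> q + n" for x y
  proof (cases "tailed_color p q x = tailed_color p q y")
    case True
    have "q < y"
    proof (rule ccontr)
      assume "\<not> q < y"
      then have "tailed_color p q x = x" "tailed_color p q y = y" using xy by (auto simp: tailed_color_def)
      then show False using True xy by simp
    qed
    then obtain j where j: "y = q + j" "1 \<le> j" "j \<le> n"
      using xy that[of "y - q"] by auto
    have q3: "3 \<le> q" using assms j by auto
    define t where "t = (if p = 2 then q else 2)"
    have t: "1 \<le> t" "t \<le> q" using assms q3 by (auto simp: t_def)
    have cls: "color_class ?G (tailed_color p q) t = {t}"
      using assms q3 by (intro color_class_tailed_color) (auto simp: t_def)
    have dy: "set_dist ?G y {t} = ereal (real (if t = q then j else Suc j))"
      using set_dist_tail assms t j by simp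
    \<comment> \<open>On the path, distances to \<open>t\<close> are strictly increasing. A vertex
      \<open>x\<close> below \<open>q\<close> of the same color as \<open>y\<close> has distance 1,
      while \<open>y\<close> has distance \<open>j\<close> or \<open>Suc j\<close>. A tie forces
      \<open>p = 2\<close> and \<open>j = 1\<close>, so \<open>y\<close> has color 1 and
      \<open>x = 1\<close>.\<close>
    consider (dist) "set_dist ?G x {t} \<noteq> set_dist ?G y {t}" | (first) "p = 2" "x = 1" "j = 1"
    proof (cases "q \<le> x")
      case ge: True
      then have "set_dist ?G x {t} = ereal (real (if t = q then x - q else Suc (x - q)))"
        using set_dist_tail[of p q t "x - q" n] assms t xy by simp
      with dy j xy ge show ?thesis by (intro dist) auto
    next
      case False
      then have x: "tailed_color p q x = x" "x < q" by (auto simp: tailed_color_def)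
      then have x2: "x = 1 \<or> p = 2 \<and> x = 2 \<and> even j"
        using True j q3 by (auto simp: tailed_color_def split: if_splits)
      then have adj: "(x, t) \<in> parcs ?G"
        using assms q3 t x by (auto simp: tailed_adj_def t_def)
      moreover have "x \<noteq> t" using x2 x by (auto simp: t_def)
      ultimately have "set_dist ?G x {t} = 1" by (intro set_dist_adjacent) auto
      with dy j x2 show ?thesis using dist first q3
        by (cases "p = 2") (auto simp: t_def one_ereal_def split: if_splits)
    qed
    then show ?thesis
    proof cases
      case dist
      then show ?thesis unfolding metric_distinguished_def using cls t
        by (intro bexI[of _ t]) auto
    next
      case first
      then have n: "2 \<le> n" using assms j by auto
      \<comment> \<open>Color 2 breaks the tie: it occurs at \<open>q + 2\<close> next to
        \<open>y\<close>, while the only neighbor of \<open>1\<close> is \<open>q\<close>, of color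
        \<open>q \<ge> 3\<close>.\<close>
      let ?S = "color_class ?G (tailed_color p q) 2"
      have "(y, q + 2) \<in> parcs ?G" using first n j by (auto simp: tailed_adj_def)
      moreover have "q + 2 \<in> ?S" "y \<notin> ?S" using first n j by (auto simp: color_class_def tailed_color_def)
      ultimately have "set_dist ?G y ?S = 1" using set_dist_adjacent by blast
      moreover have "2 \<le> set_dist ?G x ?S"
        using first q3
        by (intro set_dist_ge_two) (auto simp: color_class_def tailed_color_def tailed_adj_def split: if_splits)
      moreover have "2 \<in> {1..q}" using q3 by auto
      moreover have "\<not> (2 :: ereal) \<le> 1" by (simp add: numeral_eq_ereal one_ereal_def)
      ultimately show ?thesis unfolding metric_distinguished_def by metis
    qed
  qed (use xy proper in \<open>auto intro: metric_distinguished_if_color_neq\<close>)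
  then show ?thesis
    unfolding locating_coloring_def using proper
    by (metis metric_distinguished_commute atLeastAtMost_iff linorder_neqE_nat tailed_graph_simps(1))
qed

lemma locating_chromatic_number_tailed_graph:
  assumes "2 \<le> p" "p \<le> q" "n = 0 \<or> 3 \<le> q \<and> (p = 2 \<longrightarrow> 2 \<le> n)"
  shows "locating_chromatic_number (tailed_graph p q n) = q"
  unfolding locating_chromatic_number_def
proof (rule Least_equality)
  show "\<exists>f. locating_coloring (tailed_graph p q n) q f"
    using locating_coloring_tailed_color[OF assms] by blast
next
  interpret pair_graph "tailed_graph p q n" by (rule pair_graph_tailed_graph)
  fix k assume "\<exists>f. locating_coloring (tailed_graph p q n) k f"
  then obtain f where f: "locating_coloring (tailed_graph p q n) k f" by blast
  then have proper: "proper_coloring (tailed_graph p q n) k f" by (simp add: locating_coloring_def)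
  have "inj_on f {1..q}"
  proof (rule linorder_inj_onI)
    fix x y assume xy: "x < y" "x \<in> {1..q}" "y \<in> {1..q}"
    show "f x \<noteq> f y"
    proof (cases "tailed_adj p q x y")
      case True
      with xy have "(x, y) \<in> parcs (tailed_graph p q n)" by auto
      then show ?thesis using proper unfolding proper_coloring_def by blast
    next
      case False
      \<comment> \<open>Nonadjacent vertices both lie in the large part. The path is attached at
        \<open>q\<close> only, so they are twins in the whole graph.\<close>
      with xy have "p - 1 \<le> x" "y < q" by (auto simp: tailed_adj_def split: if_splits)
      with xy have "{w. (x, w) \<in> parcs (tailed_graph p q n)} = {w. (y, w) \<in> parcs (tailed_graph p q n)}"
        by (auto simp: tailed_adj_def split: if_splits)
      with xy show ?thesis by (intro locating_coloring_twins[OF f]) auto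
    qed
  qed auto
  from proper_coloring_card_le[OF proper this] show "q \<le> k" by simp
qed

section \<open>The neighbor-locating chromatic number along the growing path\<close>

text \<open>The color \<open>Suc k\<close> occurs only on the new end vertex. Removing it from the
  color-neighbors of an old vertex restores the former set, so old vertices of equal color remain
  distinguished.\<close>

lemma neighbor_locating_coloring_tailed_graph_Suc:
  assumes "neighbor_locating_coloring (tailed_graph p q n) k f"
  shows "neighbor_locating_coloring (tailed_graph p q (Suc n)) (Suc k) (f(Suc (q + n) := Suc k))"
    (is "neighbor_locating_coloring ?H _ ?g")
proof -
  let ?G = "tailed_graph p q n" and ?z = "Suc (q + n)"
  have f: "f ` {1..q + n} = {1..k}" "\<And>x y. (x, y) \<in> parcs ?G \<Longrightarrow> f x \<noteq> f y"
    and dist: "\<And>x y. x \<in> {1..q + n} \<Longrightarrow> y \<in> {1..q + n} \<Longrightarrow> x \<noteq> y \<Longrightarrow> f x = f y \<Longrightarrow>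
      color_neighbors ?G f x \<noteq> color_neighbors ?G f y"
    using assms
    unfolding neighbor_locating_coloring_def proper_coloring_def neighbor_distinguished_def by auto
  have bound: "f x \<le> k" if "x \<in> {1..q + n}" for x using f that by fastforce
  have old: "(x, y) \<in> parcs ?H \<longleftrightarrow> (x, y) \<in> parcs ?G" if "x \<noteq> ?z" "y \<noteq> ?z" for x y
    using that by (auto simp: le_Suc_eq)
  have "?g ` {1..Suc (q + n)} = insert (Suc k) (f ` {1..q + n})"
    by (auto simp: atLeastAtMostSuc_conv)
  also have "\<dots> = insert (Suc k) {1..k}" by (simp only: f(1))
  also have "\<dots> = {1..Suc k}" by auto
  finally have "?g ` {1..Suc (q + n)} = {1..Suc k}" .
  moreover have "\<forall>(x, y) \<in> parcs ?H. ?g x \<noteq> ?g y"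
  proof safe
    fix x y assume arc: "(x, y) \<in> parcs ?H" and eq: "?g x = ?g y"
    from arc have xy: "x \<in> {1..Suc (q + n)}" "y \<in> {1..Suc (q + n)}" "x \<noteq> y"
      by (auto simp: tailed_adj_def)
    show False
    proof (cases "x \<noteq> ?z \<and> y \<noteq> ?z")
      case True
      then show False using arc eq old[of x y] f(2)[of x y] by (simp del: tailed_graph_simps)
    next
      case False
      then show False using xy eq bound[of x] bound[of y] by (auto simp: le_Suc_eq)
    qed
  qed
  moreover have "neighbor_distinguished ?H ?g x y"
    if xy: "x \<in> {1..Suc (q + n)}" "y \<in> {1..Suc (q + n)}" "x \<noteq> y" for x y
  proof (cases "x \<noteq> ?z \<and> y \<noteq> ?z \<and> f x = f y")
    case True
    have without_new: "color_neighbors ?H ?g v - {Suc k} = color_neighbors ?G f v" if v: "v \<noteq> ?z" for v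
    proof -
      have "color_neighbors ?H ?g v - {Suc k} = ?g ` {w. (v, w) \<in> parcs ?H \<and> ?g w \<noteq> Suc k}"
        by (auto simp: color_neighbors_def)
      also have "{w. (v, w) \<in> parcs ?H \<and> ?g w \<noteq> Suc k} = {w. (v, w) \<in> parcs ?G}"
        using v bound by (fastforce simp: le_Suc_eq)
      also have "?g ` \<dots> = f ` \<dots>" by (intro image_cong) auto
      finally show ?thesis by (simp add: color_neighbors_def)
    qed
    have "color_neighbors ?G f x \<noteq> color_neighbors ?G f y"
      using True xy by (intro dist) auto
    then show ?thesis
      using True without_new unfolding neighbor_distinguished_def by metis
  next
    case False
    then show ?thesis
      using xy bound[of x] bound[of y] by (auto simp: neighbor_distinguished_def le_Suc_eq)
  qed
  ultimately show ?thesis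
    unfolding neighbor_locating_coloring_def proper_coloring_def tailed_graph_simps(1) add_Suc_right
    by (intro conjI) (assumption | intro ballI impI)+
qed

text \<open>This makes the minimum well defined, and for \<open>n = 0\<close> it bounds the starting
  value by \<open>q\<close>.\<close>

lemma neighbor_locating_coloring_tailed_graph_inj:
  "neighbor_locating_coloring (tailed_graph p q n) (q + n) id"
  by (auto simp: neighbor_locating_coloring_def proper_coloring_def neighbor_distinguished_def
      tailed_adj_def)

lemma ex_neighbor_locating_coloring_tailed_graph:
  "\<exists>f. neighbor_locating_coloring (tailed_graph p q n)
     (neighbor_locating_chromatic_number (tailed_graph p q n)) f"
  unfolding neighbor_locating_chromatic_number_def
  by (rule LeastI[where P = "\<lambda>k. \<exists>f. neighbor_locating_coloring (tailed_graph p q n) k f"])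
    (use neighbor_locating_coloring_tailed_graph_inj in blast)

lemma neighbor_locating_chromatic_number_le:
  "neighbor_locating_coloring G k f \<Longrightarrow> neighbor_locating_chromatic_number G \<le> k"
  unfolding neighbor_locating_chromatic_number_def by (rule Least_le) blast

lemma neighbor_locating_chromatic_number_tailed_graph_Suc:
  "neighbor_locating_chromatic_number (tailed_graph p q (Suc n))
     \<le> Suc (neighbor_locating_chromatic_number (tailed_graph p q n))"
  using ex_neighbor_locating_coloring_tailed_graph neighbor_locating_coloring_tailed_graph_Suc
    neighbor_locating_chromatic_number_le by metis

lemma neighbor_locating_chromatic_number_tailed_graph_unbounded:
  "\<exists>n\<ge>m. r \<le> neighbor_locating_chromatic_number (tailed_graph p q n)"
proof (intro exI conjI)
  \<comment> \<open>The graph then has more than \<open>r * 2 ^ r\<close> vertices, which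
    \<open>r\<close> or fewer colors cannot distinguish.\<close>
  define n where "n = m + Suc (r * 2 ^ r)"
  define k where "k = neighbor_locating_chromatic_number (tailed_graph p q n)"
  show "m \<le> n" by (simp add: n_def)
  obtain f where "neighbor_locating_coloring (tailed_graph p q n) k f"
    using ex_neighbor_locating_coloring_tailed_graph unfolding k_def by blast
  from neighbor_locating_coloring_card_le[OF this pair_wf_tailed_graph]
  have "r * 2 ^ r < k * 2 ^ k" by (simp add: n_def)
  moreover have "k * 2 ^ k \<le> r * 2 ^ r" if "k \<le> r"
    using that by (intro mult_le_mono power_increasing) auto
  ultimately show "r \<le> neighbor_locating_chromatic_number (tailed_graph p q n)"
    unfolding k_def[symmetric] by linarith
qed

text \<open>For \<open>p = 2\<close> the length \<open>n = 1\<close> is not covered by the locating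
  result, so the growth starts at 2, where \<open>tailed_color\<close> still needs only
  \<open>q\<close> colors.\<close>

lemma neighbor_locating_chromatic_number_tailed_graph_base:
  assumes "2 \<le> p" "p \<le> q" "n = (if p = 2 \<and> 3 \<le> q then 2 else 0)"
  shows "neighbor_locating_chromatic_number (tailed_graph p q n) \<le> q"
proof (cases "p = 2 \<and> 3 \<le> q")
  case True
  let ?f = "tailed_color p q" and ?G = "tailed_graph p q n"
  have n: "n = 2" using True assms by simp
  \<comment> \<open>The only pairs of equal color are \<open>1\<close>, \<open>q + 1\<close> and
    \<open>2\<close>, \<open>q + 2\<close>. Color 2 is adjacent to \<open>q + 1\<close> but not to
    \<open>1\<close>; color \<open>q\<close> is adjacent to \<open>2\<close> but not to
    \<open>q + 2\<close>.\<close>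
  have nb: "q \<in> color_neighbors ?G ?f v" if "v \<in> {1..<q}" for v
    unfolding color_neighbors_def using that True
    by (intro image_eqI[of _ _ q]) (auto simp: tailed_adj_def tailed_color_def)
  have "2 \<in> color_neighbors ?G ?f (q + 1)"
    unfolding color_neighbors_def using n True
    by (intro image_eqI[of _ _ "q + 2"]) (auto simp: tailed_adj_def tailed_color_def)
  moreover have "2 \<notin> color_neighbors ?G ?f 1"
    using n True by (auto simp: color_neighbors_def tailed_adj_def tailed_color_def split: if_splits)
  moreover have "q \<notin> color_neighbors ?G ?f (q + 2)"
    using n True by (auto simp: color_neighbors_def tailed_adj_def tailed_color_def split: if_splits)
  ultimately have d: "color_neighbors ?G ?f 1 \<noteq> color_neighbors ?G ?f (q + 1)"
    "color_neighbors ?G ?f 2 \<noteq> color_neighbors ?G ?f (q + 2)"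
    using nb[of 2] True by auto
  have sep: "neighbor_distinguished ?G ?f x y" if xy: "1 \<le> x" "x < y" "y \<le> q + 2" for x y
  proof -
    from xy consider "x \<noteq> y" "x \<le> q" "y \<le> q" | "y = q + 1" "x = 1" | "y = q + 1" "x \<noteq> 1" "x \<le> q"
      | "y = q + 2" "x = 2" | "y = q + 2" "x \<noteq> 2" "x \<le> q" | "y = q + 2" "x = q + 1" by linarith
    then show ?thesis
      unfolding neighbor_distinguished_def
      by cases (use d True in \<open>simp_all add: tailed_color_def\<close>)
  qed
  have "neighbor_locating_coloring ?G q ?f"
    unfolding neighbor_locating_coloring_def
  proof (intro conjI ballI impI)
    show "proper_coloring ?G q ?f" using assms by (intro proper_coloring_tailed_color)
    fix x y assume "x \<in> pverts ?G" "y \<in> pverts ?G" "x \<noteq> y"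
    then show "neighbor_distinguished ?G ?f x y"
      using sep[of x y] sep[of y x] n unfolding neighbor_distinguished_def
      by (cases x y rule: linorder_cases) force+
  qed
  then show ?thesis by (rule neighbor_locating_chromatic_number_le)
next
  case False
  then have "n = 0" using assms by auto
  with neighbor_locating_chromatic_number_le[OF neighbor_locating_coloring_tailed_graph_inj[of p q n]]
  show ?thesis by simp
qed

section \<open>Choice of the path length\<close>

theorem theorem1:
  fixes p q r :: nat
  assumes "2 \<le> p" and "p \<le> q" and "q \<le> r"
    and "\<not> (p = 2 \<and> q = 2 \<and> r > 2)"
  shows "\<exists>G :: nat pair_pre_digraph. pair_graph G \<and> Digraph_Component.connected (with_proj G) \<and>
    chromatic_number G = p \<and> locating_chromatic_number G = q \<and>
    neighbor_locating_chromatic_number G = r"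
proof -
  let ?F = "\<lambda>n. neighbor_locating_chromatic_number (tailed_graph p q n)"
  define m :: nat where "m = (if p = 2 \<and> 3 \<le> q then 2 else 0)"
  have m: "?F m \<le> q"
    using neighbor_locating_chromatic_number_tailed_graph_base assms m_def by simp
  \<comment> \<open>The condition on \<open>n\<close> is the one under which the locating chromatic
    number is \<open>q\<close>.\<close>
  have "\<exists>n. (n = 0 \<or> 3 \<le> q \<and> (p = 2 \<longrightarrow> 2 \<le> n)) \<and> ?F n = r"
  proof (cases "3 \<le> q")
    case True
    have "\<exists>n\<ge>m. ?F n = r"
      using m assms(3) neighbor_locating_chromatic_number_tailed_graph_Suc
        neighbor_locating_chromatic_number_tailed_graph_unbounded
      by (intro least_step_bounded_nat) auto
    then obtain n where "m \<le> n" "?F n = r" by blast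
    then show ?thesis using True by (intro exI[of _ n]) (auto simp: m_def)
  next
    case False
    \<comment> \<open>The excluded case leaves only \<open>r = 2\<close>. The graph is a single
      edge, and its value is squeezed between the chromatic number 2 and the bound
      \<open>q = 2\<close>.\<close>
    then have eq: "p = 2" "q = 2" "r = 2" using assms by auto
    obtain f where "neighbor_locating_coloring (tailed_graph p q 0) (?F 0) f"
      using ex_neighbor_locating_coloring_tailed_graph by blast
    then have "\<exists>f. proper_coloring (tailed_graph p q 0) (?F 0) f"
      unfolding neighbor_locating_coloring_def by blast
    then have "chromatic_number (tailed_graph p q 0) \<le> ?F 0"
      unfolding chromatic_number_def by (rule Least_le)
    then have "?F 0 = r"
      using chromatic_number_tailed_graph[of p q 0] m eq by (simp add: m_def)
    then show ?thesis by blast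
  qed
  then show ?thesis
    using pair_graph_tailed_graph connected_tailed_graph chromatic_number_tailed_graph
      locating_chromatic_number_tailed_graph assms by metis
qed

end
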